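(* There is an algorithm which, given an $n$-point metric space $(X,\rho)$, runs in time $O(n^2)$ and outputs a set $\mathcal{O}\subseteq X$ such that $(X\setminus \mathcal{O},\rho)$ is an ultrametric and $|\mathcal{O}|\le 3\,|\mathcal{O}^*|$, where $\mathcal{O}^*$ is a minimum-cardinality subset of $X$ for which $(X\setminus\mathcal{O}^*,\rho)$ is an ultrametric. That is, there is a $3$-approximation algorithm for minimum outlier embedding into ultrametrics with running time $O(n^2)$.
   Context: A metric space $(X,\rho)$ is an ultrametric if $\rho(x,y)\le\max\{\rho(x,z),\rho(z,y)\}$ for all $x,y,z\in X$. The minimum outlier embedding problem into ultrametrics asks, given a finite metric space $(X,\rho)$ (given by its distance matrix, with distances accessible in constant time), for a minimum-size set $\mathcal{O}\subseteq X$ (the outliers) such that $(X\setminus\mathcal{O},\rho)$ is an ultrametric (equivalently, admits an isometric embedding into an ultrametric). *)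

theory Defs
  imports "HOL-Analysis.Analysis" "HOL-Library.Landau_Symbols"
begin

section \<open>Outlier sets for ultrametrics\<close>

definition ultrametric_on :: "'a set \<Rightarrow> ('a \<Rightarrow> 'a \<Rightarrow> real) \<Rightarrow> bool" where
  "ultrametric_on X \<rho> \<longleftrightarrow>
     Metric_space X \<rho> \<and> (\<forall>x\<in>X. \<forall>y\<in>X. \<forall>z\<in>X. \<rho> x y \<le> max (\<rho> x z) (\<rho> z y))"

definition outlier_set :: "'a set \<Rightarrow> ('a \<Rightarrow> 'a \<Rightarrow> real) \<Rightarrow> 'a set \<Rightarrow> bool" where
  "outlier_set X \<rho> Out \<longleftrightarrow> Out \<subseteq> X \<and> ultrametric_on (X - Out) \<rho>"

definition min_outlier_set :: "'a set \<Rightarrow> ('a \<Rightarrow> 'a \<Rightarrow> real) \<Rightarrow> 'a set \<Rightarrow> bool" where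
  "min_outlier_set X \<rho> Out \<longleftrightarrow> is_arg_min card (outlier_set X \<rho>) Out"


section \<open>Machine model\<close>

text \<open>
  A structured, unit-cost random access machine with distance access in constant time.
  The memory has scalar variables and arrays, each holding either natural numbers or reals.
  Every instruction and every test costs one unit of time.

  The instruction set is deliberately poor, so that time bounds carry over to the usual models.
  On natural numbers there are only constants, successor, predecessor and comparison: after
  \<open>t\<close> steps on an input of size \<open>n\<close> a program has stored only numbers at most
  \<open>n + t + k\<close>, with
  \<open>k\<close> depending on the program alone, so no use can be made of unit cost on huge numbers.
  Reals can only be read from the distance matrix, copied and compared; apart from the initial
  value 0 of the memory, every real stored is an entry of the distance matrix.
\<close>

type_synonym vname = string

record state =
  nvar :: "vname \<Rightarrow> nat"
  narr :: "vname \<Rightarrow> nat \<Rightarrow> nat"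
  rvar :: "vname \<Rightarrow> real"
  rarr :: "vname \<Rightarrow> nat \<Rightarrow> real"

datatype instr =
    NConst vname nat
  | NCopy vname vname
  | NSuc vname
  | NPred vname
  | NLoad vname vname vname    \<comment> \<open>\<open>x := a[i]\<close>\<close>
  | NStore vname vname vname   \<comment> \<open>\<open>a[i] := x\<close>\<close>
  | RDist vname vname vname    \<comment> \<open>\<open>r := d(i, j)\<close>\<close>
  | RCopy vname vname
  | RLoad vname vname vname
  | RStore vname vname vname

datatype test =
    NLess vname vname
  | NEq vname vname
  | RLess vname vname
  | REq vname vname

datatype com =
    Skip
  | Instr instr
  | Seq com com
  | If test com com
  | While test com

text \<open>
  The input is a number \<open>n\<close> and a matrix \<open>d\<close>, of which only the entries with indices below \<open>n\<close>
  can be read: the machine gets stuck (\<open>None\<close>) on any other access.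
\<close>

fun exec_instr :: "nat \<Rightarrow> (nat \<Rightarrow> nat \<Rightarrow> real) \<Rightarrow> instr \<Rightarrow> state \<Rightarrow> state option" where
  "exec_instr n d (NConst x k) s = Some (s\<lparr>nvar := (nvar s)(x := k)\<rparr>)"
| "exec_instr n d (NCopy x y) s = Some (s\<lparr>nvar := (nvar s)(x := nvar s y)\<rparr>)"
| "exec_instr n d (NSuc x) s = Some (s\<lparr>nvar := (nvar s)(x := nvar s x + 1)\<rparr>)"
| "exec_instr n d (NPred x) s = Some (s\<lparr>nvar := (nvar s)(x := nvar s x - 1)\<rparr>)"
| "exec_instr n d (NLoad x a i) s = Some (s\<lparr>nvar := (nvar s)(x := narr s a (nvar s i))\<rparr>)"
| "exec_instr n d (NStore a i x) s =
     Some (s\<lparr>narr := (narr s)(a := (narr s a)(nvar s i := nvar s x))\<rparr>)"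
| "exec_instr n d (RDist r i j) s =
     (if nvar s i < n \<and> nvar s j < n
      then Some (s\<lparr>rvar := (rvar s)(r := d (nvar s i) (nvar s j))\<rparr>) else None)"
| "exec_instr n d (RCopy r q) s = Some (s\<lparr>rvar := (rvar s)(r := rvar s q)\<rparr>)"
| "exec_instr n d (RLoad r b i) s = Some (s\<lparr>rvar := (rvar s)(r := rarr s b (nvar s i))\<rparr>)"
| "exec_instr n d (RStore b i r) s =
     Some (s\<lparr>rarr := (rarr s)(b := (rarr s b)(nvar s i := rvar s r))\<rparr>)"

fun holds :: "test \<Rightarrow> state \<Rightarrow> bool" where
  "holds (NLess x y) s \<longleftrightarrow> nvar s x < nvar s y"
| "holds (NEq x y) s \<longleftrightarrow> nvar s x = nvar s y"
| "holds (RLess r q) s \<longleftrightarrow> rvar s r < rvar s q"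
| "holds (REq r q) s \<longleftrightarrow> rvar s r = rvar s q"

text \<open>\<open>exec n d c s t s'\<close>: started in \<open>s\<close>, the command \<open>c\<close> halts in \<open>s'\<close> after time \<open>t\<close>.\<close>

inductive exec :: "nat \<Rightarrow> (nat \<Rightarrow> nat \<Rightarrow> real) \<Rightarrow> com \<Rightarrow> state \<Rightarrow> nat \<Rightarrow> state \<Rightarrow> bool"
  for n :: nat and d :: "nat \<Rightarrow> nat \<Rightarrow> real" where
  Skip: "exec n d Skip s 1 s"
| Instr: "exec_instr n d i s = Some s' \<Longrightarrow> exec n d (Instr i) s 1 s'"
| Seq: "exec n d c1 s t1 s1 \<Longrightarrow> exec n d c2 s1 t2 s2 \<Longrightarrow> exec n d (Seq c1 c2) s (t1 + t2) s2"
| IfTrue: "holds b s \<Longrightarrow> exec n d c1 s t s' \<Longrightarrow> exec n d (If b c1 c2) s (t + 1) s'"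
| IfFalse: "\<not> holds b s \<Longrightarrow> exec n d c2 s t s' \<Longrightarrow> exec n d (If b c1 c2) s (t + 1) s'"
| WhileFalse: "\<not> holds b s \<Longrightarrow> exec n d (While b c) s 1 s"
| WhileTrue: "holds b s \<Longrightarrow> exec n d c s t1 s1 \<Longrightarrow> exec n d (While b c) s1 t2 s2 \<Longrightarrow>
    exec n d (While b c) s (t1 + t2 + 1) s2"

inductive_cases exec_SkipE: "exec n d Skip s t s'"
  and exec_InstrE: "exec n d (Instr i) s t s'"
  and exec_SeqE: "exec n d (Seq c1 c2) s t s'"
  and exec_IfE: "exec n d (If b c1 c2) s t s'"
  and exec_WhileE: "exec n d (While b c) s t s'"

lemma exec_deterministic:
  "exec n d c s t s' \<Longrightarrow> exec n d c s u s'' \<Longrightarrow> u = t \<and> s'' = s'"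
proof (induction arbitrary: u s'' rule: exec.induct)
  case (Skip s)
  then show ?case by (auto elim: exec_SkipE)
next
  case (Instr i s s')
  then show ?case by (auto elim: exec_InstrE)
next
  case (Seq c1 s t1 s1 c2 t2 s2)
  from Seq.prems show ?case by (rule exec_SeqE) (auto dest!: Seq.IH)
next
  case (IfTrue b s c1 t s' c2)
  from IfTrue.prems show ?case by (rule exec_IfE) (use IfTrue.hyps in \<open>auto dest!: IfTrue.IH\<close>)
next
  case (IfFalse b s c2 t s' c1)
  from IfFalse.prems show ?case by (rule exec_IfE) (use IfFalse.hyps in \<open>auto dest!: IfFalse.IH\<close>)
next
  case (WhileFalse b s c)
  from WhileFalse.prems show ?case by (rule exec_WhileE) (use WhileFalse.hyps in auto)
next
  case (WhileTrue b s c t1 s1 t2 s2)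
  from WhileTrue.prems show ?case
    by (rule exec_WhileE) (use WhileTrue.hyps in \<open>auto dest!: WhileTrue.IH\<close>)
qed

text \<open>
  Conventions for input and output: the size \<open>n\<close> is initially in the variable \<open>''n''\<close>, all other
  memory is 0, and the output set is given by its characteristic vector in the array \<open>''out''\<close>.
\<close>

definition initial_state :: "nat \<Rightarrow> state" where
  "initial_state n =
     \<lparr>nvar = (\<lambda>_. 0)(''n'' := n), narr = (\<lambda>_ _. 0), rvar = (\<lambda>_. 0), rarr = (\<lambda>_ _. 0)\<rparr>"

definition output_set :: "nat \<Rightarrow> state \<Rightarrow> nat set" where
  "output_set n s = {i. i < n \<and> narr s ''out'' i \<noteq> 0}"

definition outputs_in_time ::
  "com \<Rightarrow> nat \<Rightarrow> (nat \<Rightarrow> nat \<Rightarrow> real) \<Rightarrow> nat \<Rightarrow> nat set \<Rightarrow> bool" where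
  "outputs_in_time P n d t Out \<longleftrightarrow>
     (\<exists>s. exec n d P (initial_state n) t s \<and> Out = output_set n s)"

end

theory Submission
  imports Defs
begin

text \<open>
  The points are inserted one at a time while the set \<open>S\<close> of surviving points is kept ultrametric.
  Let \<open>q\<close> be a point of \<open>S\<close> nearest to the new point \<open>p\<close>. Then \<open>S \<union> {p}\<close> is ultrametric iff
  \<open>\<rho> p x = max (\<rho> p q) (\<rho> q x)\<close> for all \<open>x \<in> S\<close>, which takes linear time to test, and if this fails at
  \<open>x\<close> then the triple \<open>p, q, x\<close> violates the ultrametric inequality. In that case all three points
  become outliers. The triples discarded in this way are disjoint, and each of them meets every
  outlier set.
\<close>

section \<open>Extending an ultrametric by one point\<close>

text \<open>By \<open>eq\<close>, the point \<open>q\<close> determines all distances from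
  \<open>p\<close> to \<open>S\<close>, so an inequality involving \<open>p\<close> reduces to one
  for a triple in \<open>S\<close> with \<open>q\<close> in place of \<open>p\<close>.\<close>

lemma ultrametric_on_insert:
  assumes S: "ultrametric_on S \<rho>" and M: "Metric_space (insert p S) \<rho>"
    and q: "q \<in> S" and eq: "\<And>x. x \<in> S \<Longrightarrow> \<rho> p x = max (\<rho> p q) (\<rho> q x)"
  shows "ultrametric_on (insert p S) \<rho>"
proof -
  interpret Metric_space "insert p S" \<rho> by (fact M)
  have um: "\<rho> x y \<le> max (\<rho> x z) (\<rho> z y)" if "x \<in> S" "y \<in> S" "z \<in> S" for x y z
    using S that unfolding ultrametric_on_def by blast
  \<comment> \<open>\<open>p\<close> as an endpoint: \<open>\<rho> q y\<close> is bounded through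
    \<open>z\<close>, and by \<open>eq\<close> both \<open>\<rho> p q\<close> and
    \<open>\<rho> q z\<close> are at most \<open>\<rho> p z\<close>.\<close>
  have um_p: "\<rho> p y \<le> max (\<rho> p z) (\<rho> z y)" if "y \<in> S" "z \<in> S" for y z
    using um[of q y z] eq[of y] eq[of z] q that by auto
  \<comment> \<open>\<open>p\<close> as the intermediate point: by \<open>eq\<close>, passing
    through \<open>p\<close> instead of \<open>q\<close> only increases both distances.\<close>
  have um_mid: "\<rho> x y \<le> max (\<rho> x p) (\<rho> p y)" if "x \<in> S" "y \<in> S" for x y
    using um[of x y q] eq[of x] eq[of y] q that commute[of x p] commute[of x q] by auto
  have pp: "\<rho> p p = 0"
    using zero[of p p] by simp
  have "\<rho> x y \<le> max (\<rho> x z) (\<rho> z y)"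
    if xyz: "x \<in> insert p S" "y \<in> insert p S" "z \<in> insert p S" for x y z
  proof -
    \<comment> \<open>Unless two of the three points coincide, at most one of them is
      \<open>p\<close>.\<close>
    consider "x = y" | "z = x" | "z = y" | "x \<in> S" "y \<in> S" "z \<in> S"
      | "x = p" "y \<in> S" "z \<in> S" | "y = p" "x \<in> S" "z \<in> S" | "z = p" "x \<in> S" "y \<in> S"
      using xyz by blast
    then show ?thesis
    proof cases
      case 1
      then show ?thesis using nonneg[of x z] zero[of y y] xyz by (simp add: le_max_iff_disj)
    next
      case 6
      then show ?thesis using um_p[of x z] commute by (simp add: max.commute)
    qed (use um um_p um_mid in auto)
  qed
  then show ?thesis
    using M unfolding ultrametric_on_def by blast
qed

text \<open>If all three points survived, \<open>\<rho> p x\<close> would be at most the maximum;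
  the inequality for \<open>q, x\<close> through \<open>p\<close>, combined with
  \<open>near\<close>, would give \<open>\<rho> q x \<le> \<rho> p x\<close>. Together these force
  the equality excluded by \<open>ne\<close>.\<close>

lemma outlier_set_meets_violation:
  assumes C: "outlier_set X \<rho> C" and X: "p \<in> X" "q \<in> X" "x \<in> X"
    and near: "\<rho> p q \<le> \<rho> p x" and ne: "\<rho> p x \<noteq> max (\<rho> p q) (\<rho> q x)"
  shows "{p, q, x} \<inter> C \<noteq> {}"
proof
  assume "{p, q, x} \<inter> C = {}"
  then have in_diff: "p \<in> X - C" "q \<in> X - C" "x \<in> X - C"
    using X by auto
  from C have um: "ultrametric_on (X - C) \<rho>"
    by (simp add: outlier_set_def)
  then interpret Metric_space "X - C" \<rho>
    by (simp add: ultrametric_on_def)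
  have "\<rho> p x \<le> max (\<rho> p q) (\<rho> q x)" "\<rho> q x \<le> max (\<rho> q p) (\<rho> p x)"
    using um in_diff unfolding ultrametric_on_def by blast+
  with near ne commute[of q p] show False
    by auto
qed

section \<open>Charging the outliers to an arbitrary outlier set\<close>

text \<open>The invariant after the first \<open>p\<close> insertions. Counting
  \<open>Out \<inter> C\<close> rather than \<open>C\<close> makes the bound additive over disjoint
  triples. Since \<open>C\<close> ranges over outlier sets of the whole space, no optimum of a
  prefix has to be considered.\<close>

definition charged_outliers :: "nat \<Rightarrow> (nat \<Rightarrow> nat \<Rightarrow> real) \<Rightarrow> nat \<Rightarrow> nat set \<Rightarrow> bool" where
  "charged_outliers n \<rho> p Out \<longleftrightarrow> Out \<subseteq> {..<p} \<and> ultrametric_on ({..<p} - Out) \<rho> \<and>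
     (\<forall>C. outlier_set {..<n} \<rho> C \<longrightarrow> card Out \<le> 3 * card (Out \<inter> C))"

lemma charged_outliers_0:
  assumes "Metric_space {..<n} \<rho>"
  shows "charged_outliers n \<rho> 0 {}"
  using Metric_space.subspace[OF assms, of "{}"]
  by (auto simp: charged_outliers_def ultrametric_on_def)

lemma charged_outliers_keep:
  assumes M: "Metric_space {..<n} \<rho>" and p: "p < n" and Out: "charged_outliers n \<rho> p Out"
    and q: "q \<in> {..<p} - Out \<or> {..<p} - Out = {}"
    and eq: "\<And>x. x \<in> {..<p} - Out \<Longrightarrow> \<rho> p x = max (\<rho> p q) (\<rho> q x)"
  shows "charged_outliers n \<rho> (Suc p) Out"
proof -
  let ?S = "{..<p} - Out"
  have sub: "Out \<subseteq> {..<p}" and um: "ultrametric_on ?S \<rho>"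
    using Out by (auto simp: charged_outliers_def)
  have M': "Metric_space (insert p ?S) \<rho>"
    by (rule Metric_space.subspace[OF M]) (use p in auto)
  have "ultrametric_on (insert p ?S) \<rho>"
  proof (cases "?S = {}")
    case True
    then show ?thesis
      using M' unfolding True ultrametric_on_def by simp
  next
    case False
    then show ?thesis
      using ultrametric_on_insert[OF um M' _ eq] q by blast
  qed
  moreover have "{..<Suc p} - Out = insert p ?S"
    using sub by auto
  ultimately show ?thesis
    using Out by (auto simp: charged_outliers_def)
qed

text \<open>The three discarded points are distinct and new, and \<open>C\<close> contains at least
  one of them, so the left side grows by 3 and the right side by at least 3. As \<open>p\<close>
  goes too, the survivors form a subset of the earlier ones.\<close>

lemma charged_outliers_discard:
  assumes M: "Metric_space {..<n} \<rho>" and p: "p < n" and Out: "charged_outliers n \<rho> p Out"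
    and q: "q \<in> {..<p} - Out" and x: "x \<in> {..<p} - Out"
    and near: "\<rho> p q \<le> \<rho> p x" and ne: "\<rho> p x \<noteq> max (\<rho> p q) (\<rho> q x)"
  shows "charged_outliers n \<rho> (Suc p) (Out \<union> {p, q, x})"
proof -
  let ?T = "{p, q, x}"
  interpret Metric_space "{..<n}" \<rho> by (fact M)
  have sub: "Out \<subseteq> {..<p}" and um: "ultrametric_on ({..<p} - Out) \<rho>"
    using Out by (auto simp: charged_outliers_def)
  have fin: "finite Out"
    using sub finite_subset by blast
  \<comment> \<open>For \<open>q = x\<close> the maximum would be
    \<open>max (\<rho> p x) 0 = \<rho> p x\<close>, against \<open>ne\<close>.\<close>
  have "q \<noteq> x"
    using ne q x p nonneg[of p x] zero[of x x] by auto
  then have card_T: "card ?T = 3"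
    using q x by auto
  have disj: "Out \<inter> ?T = {}"
    using q x sub by auto
  have "card (Out \<union> ?T) \<le> 3 * card ((Out \<union> ?T) \<inter> C)" if C: "outlier_set {..<n} \<rho> C" for C
  proof -
    have "?T \<inter> C \<noteq> {}"
      by (rule outlier_set_meets_violation[OF C _ _ _ near ne]) (use p q x in auto)
    then have "1 \<le> card (?T \<inter> C)"
      by (simp add: Suc_le_eq card_gt_0_iff)
    moreover have "card ((Out \<union> ?T) \<inter> C) = card (Out \<inter> C) + card (?T \<inter> C)"
      unfolding Int_Un_distrib2 by (rule card_Un_disjoint) (use fin disj in auto)
    moreover have "card (Out \<union> ?T) = card Out + 3"
      using card_Un_disjoint[OF fin _ disj] card_T by simp
    moreover have "card Out \<le> 3 * card (Out \<inter> C)"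
      using Out C by (simp add: charged_outliers_def)
    ultimately show ?thesis by linarith
  qed
  moreover have "ultrametric_on ({..<Suc p} - (Out \<union> ?T)) \<rho>"
  proof -
    have sub': "{..<Suc p} - (Out \<union> ?T) \<subseteq> {..<p} - Out"
      by auto
    show ?thesis
      using um Metric_space.subspace[OF _ sub'] sub' unfolding ultrametric_on_def by blast
  qed
  ultimately show ?thesis
    using sub q x by (auto simp: charged_outliers_def)
qed


section \<open>Weakest preconditions with time\<close>

text \<open>A halting run must exist, so termination and the absence of illegal matrix accesses are
  included; \<open>exec\<close> is deterministic, so this run is the only one. The postcondition
  also receives the running time.\<close>

definition wp ::
  "nat \<Rightarrow> (nat \<Rightarrow> nat \<Rightarrow> real) \<Rightarrow> com \<Rightarrow> (nat \<Rightarrow> state \<Rightarrow> bool) \<Rightarrow> state \<Rightarrow> bool" where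
  "wp n d c Q s \<longleftrightarrow> (\<exists>t s'. exec n d c s t s' \<and> Q t s')"

lemma wp_Skip [simp]: "wp n d Skip Q s \<longleftrightarrow> Q 1 s"
  unfolding wp_def by (metis exec.Skip exec_SkipE)

lemma wp_Instr [simp]:
  "wp n d (Instr i) Q s \<longleftrightarrow> (case exec_instr n d i s of None \<Rightarrow> False | Some s' \<Rightarrow> Q 1 s')"
  unfolding wp_def
  by (cases "exec_instr n d i s") (auto intro!: exI intro: exec.Instr elim!: exec_InstrE)

lemma wp_Seq [simp]:
  "wp n d (Seq c1 c2) Q s \<longleftrightarrow> wp n d c1 (\<lambda>t1. wp n d c2 (\<lambda>t2. Q (t1 + t2))) s"
  unfolding wp_def by (blast intro: exec.Seq elim: exec_SeqE)

lemma wp_If [simp]: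
  "wp n d (If b c1 c2) Q s \<longleftrightarrow>
     (if holds b s then wp n d c1 (\<lambda>t. Q (t + 1)) s else wp n d c2 (\<lambda>t. Q (t + 1)) s)"
  (is "?L \<longleftrightarrow> ?R")
proof
  show "?L \<Longrightarrow> ?R"
    unfolding wp_def by (auto elim!: exec_IfE)
  show "?R \<Longrightarrow> ?L"
    unfolding wp_def by (metis exec.IfTrue exec.IfFalse)
qed

lemma wp_mono: "wp n d c Q s \<Longrightarrow> (\<And>t s'. Q t s' \<Longrightarrow> Q' t s') \<Longrightarrow> wp n d c Q' s"
  unfolding wp_def by blast

text \<open>Each of the \<open>m\<close> rounds costs at most \<open>T\<close> for the body and 1
  for the test; the last 1 pays for the failing test. The counter \<open>k\<close> is a logical
  index of the invariant.\<close>

lemma wp_count_loop: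
  assumes test: "\<And>k s. I k s \<Longrightarrow> holds b s \<longleftrightarrow> k < m"
    and body: "\<And>k s. I k s \<Longrightarrow> k < m \<Longrightarrow> wp n d c (\<lambda>t s'. t \<le> T \<and> I (Suc k) s') s"
    and "I 0 s"
  shows "wp n d (While b c) (\<lambda>t s'. t \<le> m * (T + 1) + 1 \<and> I m s') s"
proof -
  \<comment> \<open>Generalised to an arbitrary starting index, for induction on the number of
    remaining rounds.\<close>
  have "wp n d (While b c) (\<lambda>t s'. t \<le> (m - k) * (T + 1) + 1 \<and> I m s') s"
    if "I k s" "k \<le> m" for k s
    using that
  proof (induction "m - k" arbitrary: k s)
    case 0
    then show ?case
      using test by (auto simp: wp_def intro!: exI exec.WhileFalse)
  next
    case (Suc l)
    then have k: "k < m" by simp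
    obtain t1 s1 where 1: "exec n d c s t1 s1" "t1 \<le> T" "I (Suc k) s1"
      using body[OF \<open>I k s\<close> k] by (auto simp: wp_def)
    have "l = m - Suc k" "Suc k \<le> m"
      using Suc.hyps(2) k by auto
    then obtain t2 s2 where 2: "exec n d (While b c) s1 t2 s2" "t2 \<le> (m - Suc k) * (T + 1) + 1" "I m s2"
      using Suc.hyps(1)[OF _ 1(3)] unfolding wp_def by blast
    have "exec n d (While b c) s (t1 + t2 + 1) s2"
      using exec.WhileTrue[OF _ 1(1) 2(1)] test[OF \<open>I k s\<close>] k by simp
    moreover have "m - k = Suc (m - Suc k)"
      using k by simp
    then have "t1 + t2 + 1 \<le> (m - k) * (T + 1) + 1"
      using 1(2) 2(2) by simp
    ultimately show ?case
      using 2(3) unfolding wp_def by blast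
  qed
  from this[of 0 s] show ?thesis
    using \<open>I 0 s\<close> by simp
qed


section \<open>The program\<close>

fun block :: "com list \<Rightarrow> com" where
  "block [] = Skip"
| "block (c # cs) = Seq c (block cs)"

text \<open>\<open>q = p\<close> and \<open>b = p\<close> encode that no nearest survivor, respectively no violation, was found.\<close>

definition nearest_body :: com where
  "nearest_body = block [
     Instr (NLoad ''o'' ''out'' ''i''),
     If (NEq ''o'' ''zero'')
       (block [Instr (RDist ''e'' ''p'' ''i''),
         If (NEq ''q'' ''p'')
           (block [Instr (NCopy ''q'' ''i''), Instr (RCopy ''r'' ''e'')])
           (If (RLess ''e'' ''r'')
             (block [Instr (NCopy ''q'' ''i''), Instr (RCopy ''r'' ''e'')]) Skip)])
       Skip,
     Instr (NSuc ''i'')]"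

text \<open>With \<open>\<rho> p q\<close> in \<open>''r''\<close>, comparing \<open>''r''\<close>
  and \<open>''f''\<close> selects the maximum that \<open>''e''\<close> has to equal. A later
  violation overwrites an earlier one; any of them will do.\<close>

definition check_body :: com where
  "check_body = block [
     Instr (NLoad ''o'' ''out'' ''i''),
     If (NEq ''o'' ''zero'')
       (block [Instr (RDist ''e'' ''p'' ''i''), Instr (RDist ''f'' ''q'' ''i''),
         If (RLess ''r'' ''f'')
           (If (REq ''e'' ''f'') Skip (Instr (NCopy ''b'' ''i'')))
           (If (REq ''e'' ''r'') Skip (Instr (NCopy ''b'' ''i'')))])
       Skip,
     Instr (NSuc ''i'')]"

definition discard :: com where
  "discard = block [
     If (NEq ''b'' ''p'') Skip
       (block [Instr (NStore ''out'' ''p'' ''one''), Instr (NStore ''out'' ''q'' ''one''),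
         Instr (NStore ''out'' ''b'' ''one'')]),
     Instr (NSuc ''p'')]"

definition insert_body :: com where
  "insert_body =
     Seq (block [Instr (NCopy ''q'' ''p''), Instr (NConst ''i'' 0)])
    (Seq (While (NLess ''i'' ''p'') nearest_body)
    (Seq (block [Instr (NCopy ''b'' ''p''), Instr (NConst ''i'' 0)])
    (Seq (While (NLess ''i'' ''p'') check_body)
      discard)))"

text \<open>\<open>''p''\<close> and \<open>''zero''\<close> have their value 0 from the initial
  memory, and \<open>''zero''\<close> is never written.\<close>

definition outlier_program :: com where
  "outlier_program = Seq (Instr (NSuc ''one'')) (While (NLess ''p'' ''n'') insert_body)"

section \<open>Invariants, correctness and running time of the program\<close>

definition ready :: "nat \<Rightarrow> nat \<Rightarrow> (nat \<Rightarrow> nat) \<Rightarrow> state \<Rightarrow> bool" where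
  "ready n p A s \<longleftrightarrow> nvar s ''n'' = n \<and> nvar s ''p'' = p \<and> nvar s ''zero'' = 0 \<and>
     nvar s ''one'' = 1 \<and> narr s ''out'' = A"

text \<open>\<open>k\<close> points have been scanned, the survivors being those with
  \<open>A j = 0\<close>. While none has been met, \<open>r\<close> is unconstrained.\<close>

definition is_nearest :: "(nat \<Rightarrow> nat \<Rightarrow> real) \<Rightarrow> nat \<Rightarrow> (nat \<Rightarrow> nat) \<Rightarrow> nat \<Rightarrow> nat \<Rightarrow> real \<Rightarrow> bool" where
  "is_nearest \<rho> p A k q r \<longleftrightarrow>
     q = p \<and> (\<forall>j<k. A j \<noteq> 0) \<or>
     q < k \<and> A q = 0 \<and> r = \<rho> p q \<and> (\<forall>j<k. A j = 0 \<longrightarrow> \<rho> p q \<le> \<rho> p j)"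

definition is_violation :: "(nat \<Rightarrow> nat \<Rightarrow> real) \<Rightarrow> nat \<Rightarrow> (nat \<Rightarrow> nat) \<Rightarrow> nat \<Rightarrow> nat \<Rightarrow> nat \<Rightarrow> bool" where
  "is_violation \<rho> p A q k b \<longleftrightarrow>
     b = p \<and> (\<forall>j<k. A j = 0 \<longrightarrow> \<rho> p j = max (\<rho> p q) (\<rho> q j)) \<or>
     b < k \<and> A b = 0 \<and> \<rho> p b \<noteq> max (\<rho> p q) (\<rho> q b)"

text \<open>The bound 20 is a generous constant for loop-free code, used for all three pieces of the
  program.\<close>

lemma nearest_body_correct:
  assumes "ready n p A s" "nvar s ''i'' = k" "is_nearest \<rho> p A k (nvar s ''q'') (rvar s ''r'')"
    and "k < p" "p < n"
  shows "wp n \<rho> nearest_body (\<lambda>t s'. t \<le> 20 \<and> ready n p A s' \<and> nvar s' ''i'' = Suc k \<and>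
    is_nearest \<rho> p A (Suc k) (nvar s' ''q'') (rvar s' ''r'')) s"
  using assms by (force simp: nearest_body_def ready_def is_nearest_def less_Suc_eq)

lemma check_body_correct:
  assumes "ready n p A s" "nvar s ''i'' = k" "nvar s ''q'' = q" "rvar s ''r'' = r"
    and "is_nearest \<rho> p A p q r" "is_violation \<rho> p A q k (nvar s ''b'')"
    and "k < p" "p < n"
  shows "wp n \<rho> check_body (\<lambda>t s'. t \<le> 20 \<and> ready n p A s' \<and> nvar s' ''i'' = Suc k \<and>
    nvar s' ''q'' = q \<and> rvar s' ''r'' = r \<and> is_violation \<rho> p A q (Suc k) (nvar s' ''b'')) s"
proof (cases "A k = 0")
  case True
  \<comment> \<open>The survivor \<open>k\<close> excludes the case \<open>q = p\<close> of
    \<open>is_nearest\<close>, so \<open>''r''\<close> holds \<open>\<rho> p q\<close>.\<close>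
  then have "q < p" "r = \<rho> p q"
    using assms(5,7) by (auto simp: is_nearest_def)
  then show ?thesis
    using assms True by (auto simp: check_body_def ready_def is_violation_def less_Suc_eq)
next
  case False
  then show ?thesis
    using assms by (auto simp: check_body_def ready_def is_violation_def less_Suc_eq)
qed

lemma discard_correct:
  assumes M: "Metric_space {..<n} \<rho>" and p: "p < n"
    and Out: "charged_outliers n \<rho> p {i. A i \<noteq> 0}"
    and ready: "ready n p A s"
    and q: "is_nearest \<rho> p A p (nvar s ''q'') r"
    and b: "is_violation \<rho> p A (nvar s ''q'') p (nvar s ''b'')"
  shows "wp n \<rho> discard (\<lambda>t s'. t \<le> 20 \<and>
    (\<exists>A'. ready n (Suc p) A' s' \<and> charged_outliers n \<rho> (Suc p) {i. A' i \<noteq> 0})) s"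
proof (cases "nvar s ''b'' = p")
  case True
  \<comment> \<open>The two cases of \<open>is_nearest\<close> are the two alternatives for
    \<open>q\<close> in \<open>charged_outliers_keep\<close>.\<close>
  have "charged_outliers n \<rho> (Suc p) {i. A i \<noteq> 0}"
    by (rule charged_outliers_keep[OF M p Out, where q = "nvar s ''q''"])
      (use q b True in \<open>auto simp: is_nearest_def is_violation_def\<close>)
  then show ?thesis
    using True ready by (auto simp: discard_def ready_def)
next
  case False
  let ?q = "nvar s ''q''" and ?b = "nvar s ''b''"
  \<comment> \<open>The violation \<open>?b\<close> is itself a survivor below \<open>p\<close>, so
    \<open>?q\<close> is a genuine nearest survivor and
    \<open>\<rho> p ?q \<le> \<rho> p ?b\<close>.\<close>
  have "charged_outliers n \<rho> (Suc p) ({i. A i \<noteq> 0} \<union> {p, ?q, ?b})"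
    by (rule charged_outliers_discard[OF M p Out])
      (use q b False in \<open>auto simp: is_nearest_def is_violation_def\<close>)
  moreover have "{i. A i \<noteq> 0} \<union> {p, ?q, ?b} = {i. (A(p := 1, ?q := 1, ?b := 1)) i \<noteq> 0}"
    by auto
  ultimately have "charged_outliers n \<rho> (Suc p) {i. (A(p := 1, ?q := 1, ?b := 1)) i \<noteq> 0}"
    by simp
  then show ?thesis
    using False ready
    by (auto simp: discard_def ready_def simp del: fun_upd_apply
        intro!: exI[of _ "A(p := 1, ?q := 1, ?b := 1)"]) (simp_all add: ready_def)
qed

text \<open>Two scans cost at most \<open>21 * p + 1\<close> each, the two initialising blocks 3
  each and \<open>discard\<close> at most 20; the sum \<open>42 * p + 28\<close> is below the bound
  as \<open>p < n\<close>.\<close>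

lemma insert_body_correct:
  assumes M: "Metric_space {..<n} \<rho>" and p: "p < n"
    and Out: "charged_outliers n \<rho> p {i. A i \<noteq> 0}" and ready: "ready n p A s"
  shows "wp n \<rho> insert_body (\<lambda>t s'. t \<le> 42 * n + 40 \<and>
    (\<exists>A'. ready n (Suc p) A' s' \<and> charged_outliers n \<rho> (Suc p) {i. A' i \<noteq> 0})) s"
proof -
  have nearest: "wp n \<rho> (While (NLess ''i'' ''p'') nearest_body)
      (\<lambda>t s'. t \<le> p * (20 + 1) + 1 \<and> (ready n p A s' \<and> nvar s' ''i'' = p \<and>
        is_nearest \<rho> p A p (nvar s' ''q'') (rvar s' ''r''))) s1"
    if "ready n p A s1" "nvar s1 ''i'' = 0" "nvar s1 ''q'' = p" for s1
  proof (rule wp_count_loop[where I = "\<lambda>k s'. ready n p A s' \<and> nvar s' ''i'' = k \<and>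
        is_nearest \<rho> p A k (nvar s' ''q'') (rvar s' ''r'')"], goal_cases)
    case (2 k s')
    then show ?case using nearest_body_correct p by blast
  qed (use that in \<open>auto simp: ready_def is_nearest_def\<close>)
  have check: "wp n \<rho> (While (NLess ''i'' ''p'') check_body)
      (\<lambda>t s'. t \<le> p * (20 + 1) + 1 \<and> (ready n p A s' \<and> nvar s' ''i'' = p \<and>
        nvar s' ''q'' = q \<and> rvar s' ''r'' = r \<and> is_violation \<rho> p A q p (nvar s' ''b''))) s1"
    if "ready n p A s1" "nvar s1 ''i'' = 0" "nvar s1 ''b'' = p" "nvar s1 ''q'' = q"
      "rvar s1 ''r'' = r" "is_nearest \<rho> p A p q r" for s1 q r
  proof (rule wp_count_loop[where I = "\<lambda>k s'. ready n p A s' \<and> nvar s' ''i'' = k \<and>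
        nvar s' ''q'' = q \<and> rvar s' ''r'' = r \<and> is_violation \<rho> p A q k (nvar s' ''b'')"], goal_cases)
    case (2 k s')
    then show ?case using check_body_correct[of n p A s' k q r] that(6) p by blast
  qed (use that in \<open>auto simp: ready_def is_violation_def\<close>)
  let ?post = "\<lambda>s'. \<exists>A'. ready n (Suc p) A' s' \<and>
    charged_outliers n \<rho> (Suc p) {i. A' i \<noteq> 0}"
  have second_half: "wp n \<rho> (Seq (block [Instr (NCopy ''b'' ''p''), Instr (NConst ''i'' 0)])
      (Seq (While (NLess ''i'' ''p'') check_body) discard))
      (\<lambda>t s'. t \<le> 21 * p + 24 \<and> ?post s') s1"
    if s1: "ready n p A s1" and q: "is_nearest \<rho> p A p (nvar s1 ''q'') (rvar s1 ''r'')" for s1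
  proof -
    let ?s2 = "s1\<lparr>nvar := (nvar s1)(''b'' := p, ''i'' := 0)\<rparr>"
    have "wp n \<rho> (Seq (While (NLess ''i'' ''p'') check_body) discard)
        (\<lambda>t s'. t \<le> 21 * p + 21 \<and> ?post s') ?s2"
      unfolding wp_Seq
    proof (rule wp_mono[OF check])
      fix t s'
      assume *: "t \<le> p * (20 + 1) + 1 \<and> ready n p A s' \<and> nvar s' ''i'' = p \<and>
        nvar s' ''q'' = nvar s1 ''q'' \<and> rvar s' ''r'' = rvar s1 ''r'' \<and>
        is_violation \<rho> p A (nvar s1 ''q'') p (nvar s' ''b'')"
      show "wp n \<rho> discard (\<lambda>t2 s'. t + t2 \<le> 21 * p + 21 \<and> ?post s') s'"
        by (rule wp_mono[OF discard_correct[OF M p Out, of s' "rvar s1 ''r''"]]) (use * q in auto)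
    qed (use s1 q in \<open>simp_all add: ready_def\<close>)
    then show ?thesis
      using s1 by (auto simp: ready_def elim!: wp_mono)
  qed
  let ?s0 = "s\<lparr>nvar := (nvar s)(''q'' := p, ''i'' := 0)\<rparr>"
  have "wp n \<rho> (Seq (While (NLess ''i'' ''p'') nearest_body)
      (Seq (block [Instr (NCopy ''b'' ''p''), Instr (NConst ''i'' 0)])
        (Seq (While (NLess ''i'' ''p'') check_body) discard)))
      (\<lambda>t s'. t \<le> 42 * p + 25 \<and> ?post s') ?s0"
    unfolding wp_Seq[of _ _ "While _ nearest_body"]
  proof (rule wp_mono[OF nearest])
    fix t s'
    assume *: "t \<le> p * (20 + 1) + 1 \<and> ready n p A s' \<and> nvar s' ''i'' = p \<and>
      is_nearest \<rho> p A p (nvar s' ''q'') (rvar s' ''r'')"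
    show "wp n \<rho> (Seq (block [Instr (NCopy ''b'' ''p''), Instr (NConst ''i'' 0)])
        (Seq (While (NLess ''i'' ''p'') check_body) discard))
        (\<lambda>t2 s'. t + t2 \<le> 42 * p + 25 \<and> ?post s') s'"
      by (rule wp_mono[OF second_half]) (use * in auto)
  qed (use ready in \<open>simp_all add: ready_def\<close>)
  then show ?thesis
    using ready p unfolding insert_body_def
    by (auto simp: ready_def simp del: wp_Seq[of _ _ "While _ _"] elim!: wp_mono)
qed

text \<open>There are \<open>n\<close> rounds of at most \<open>42 * n + 40\<close> plus 1 for the
  test; the final 2 is the failing test and the initialisation of \<open>''one''\<close>.\<close>

lemma outlier_program_correct:
  assumes M: "Metric_space {..<n} \<rho>"
  shows "wp n \<rho> outlier_program (\<lambda>t s. t \<le> n * (42 * n + 41) + 2 \<and>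
    charged_outliers n \<rho> n {i. narr s ''out'' i \<noteq> 0}) (initial_state n)"
proof -
  let ?I = "\<lambda>p s. \<exists>A. ready n p A s \<and> charged_outliers n \<rho> p {i. A i \<noteq> 0}"
  let ?s = "initial_state n\<lparr>nvar := (nvar (initial_state n))(''one'' := 1)\<rparr>"
  have "ready n 0 (\<lambda>_. 0) ?s"
    by (simp add: ready_def initial_state_def)
  then have "?I 0 ?s"
    using charged_outliers_0[OF M] by (intro exI[of _ "\<lambda>_. 0"]) simp
  then have "wp n \<rho> (While (NLess ''p'' ''n'') insert_body)
      (\<lambda>t s. t \<le> n * (42 * n + 40 + 1) + 1 \<and> ?I n s) ?s"
    using insert_body_correct[OF M]
    by (intro wp_count_loop[where I = ?I]) (auto simp: ready_def)
  then show ?thesis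
    unfolding outlier_program_def by (auto simp: ready_def initial_state_def add.commute elim!: wp_mono)
qed

theorem theorem4:
  shows "\<exists>(P :: com) (T :: nat \<Rightarrow> real).
    T \<in> O(\<lambda>n. real n ^ 2) \<and>
    (\<forall>(n :: nat) (\<rho> :: nat \<Rightarrow> nat \<Rightarrow> real). Metric_space {..<n} \<rho> \<longrightarrow>
      (\<exists>t Out. outputs_in_time P n \<rho> t Out \<and>
        real t \<le> T n \<and>
        outlier_set {..<n} \<rho> Out \<and>
        (\<forall>Opt. min_outlier_set {..<n} \<rho> Opt \<longrightarrow> card Out \<le> 3 * card Opt)))"
proof (intro exI[of _ outlier_program] exI[of _ "\<lambda>n. real (n * (42 * n + 41) + 2)"]
    conjI allI impI)
  show "(\<lambda>n. real (n * (42 * n + 41) + 2)) \<in> O(\<lambda>n. real n ^ 2)"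
  \<comment> \<open>\<open>85 = 42 + 41 + 2\<close>, using \<open>1 \<le> n * n\<close> and
    \<open>n \<le> n * n\<close>, hence the restriction to positive \<open>n\<close>.\<close>
  proof (rule bigoI[of _ 85], rule eventually_mono[OF eventually_ge_at_top[of 1]])
    fix n :: nat
    assume "1 \<le> n"
    then have "1 \<le> n * n" "n \<le> n * n"
      by auto
    then have "n * (42 * n + 41) + 2 \<le> 85 * n ^ 2"
      unfolding power2_eq_square distrib_left by linarith
    then have "real (n * (42 * n + 41) + 2) \<le> real (85 * n ^ 2)"
      by (rule of_nat_mono)
    then show "norm (real (n * (42 * n + 41) + 2)) \<le> 85 * norm (real n ^ 2)"
      by simp
  qed
next
  fix n :: nat and \<rho> :: "nat \<Rightarrow> nat \<Rightarrow> real"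
  assume M: "Metric_space {..<n} \<rho>"
  obtain t s where exec: "exec n \<rho> outlier_program (initial_state n) t s"
    and t: "t \<le> n * (42 * n + 41) + 2"
    and Out: "charged_outliers n \<rho> n {i. narr s ''out'' i \<noteq> 0}"
    using outlier_program_correct[OF M] unfolding wp_def by blast
  let ?Out = "{i. narr s ''out'' i \<noteq> 0}"
  \<comment> \<open>The invariant confines the marked indices to those below \<open>n\<close>, so
    the cut-off in \<open>output_set\<close> removes nothing.\<close>
  have "output_set n s = ?Out"
    using Out by (auto simp: output_set_def charged_outliers_def)
  then have "outputs_in_time outlier_program n \<rho> t ?Out"
    using exec by (auto simp: outputs_in_time_def)
  moreover have "real t \<le> real (n * (42 * n + 41) + 2)"
    using t by (rule of_nat_mono)
  moreover have "outlier_set {..<n} \<rho> ?Out"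
    using Out by (simp add: charged_outliers_def outlier_set_def)
  moreover have "card ?Out \<le> 3 * card Opt" if "min_outlier_set {..<n} \<rho> Opt" for Opt
  proof -
    have Opt: "outlier_set {..<n} \<rho> Opt"
      using that by (simp add: min_outlier_set_def is_arg_min_def)
    then have "finite Opt"
      by (auto simp: outlier_set_def intro: finite_subset)
    \<comment> \<open>The charging bound is applied with \<open>C = Opt\<close>, and finiteness of
      \<open>Opt\<close> bounds the intersection by \<open>card Opt\<close>.\<close>
    then have "card (?Out \<inter> Opt) \<le> card Opt"
      by (intro card_mono) auto
    moreover have "card ?Out \<le> 3 * card (?Out \<inter> Opt)"
      using Out Opt by (simp add: charged_outliers_def)
    ultimately show ?thesis by linarith
  qed
  ultimately show "\<exists>t Out. outputs_in_time outlier_program n \<rho> t Out \<and>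
      real t \<le> real (n * (42 * n + 41) + 2) \<and> outlier_set {..<n} \<rho> Out \<and>
      (\<forall>Opt. min_outlier_set {..<n} \<rho> Opt \<longrightarrow> card Out \<le> 3 * card Opt)"
    by blast
qed

end
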